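(* Let $\alpha>0$ be fixed and, for $\square\in\{+,*,\sharp\}$, consider the approximation problem given by the embeddings $\mathrm{id}_d\colon H^{\alpha,\square}(\mathbb{T}^d)\to L_2(\mathbb{T}^d)$, $d\in\mathbb{N}$, with respect to the worst case setting and information from $\Lambda^{\mathrm{all}}$. This problem is weakly tractable if and only if $$\begin{cases}\alpha>2 & \text{for }\square=+,\\ \alpha>1&\text{for }\square=\sharp.\end{cases}$$ If $\square=*$, then the problem is never weakly tractable. Moreover, for each $\square\in\{+,*,\sharp\}$ the problem is never uniformly weakly tractable.
   Context: Spaces. $\mathbb{T}^d=[0,2\pi]^d$ is the $d$-dimensional torus, and for $k\in\mathbb{Z}^d$ let $c_k(f):=(2\pi)^{-d/2}\int_{\mathbb{T}^d}f(x)\exp(-\mathrm{i}\,kx)\,\mathrm{d}x$ be the Fourier coefficients. $L_2(\mathbb{T}^d)$ is normed by $\|f\|_{L_2(\mathbb{T}^d)}=\big[\sum_{k\in\mathbb{Z}^d}|c_k(f)|^2\big]^{1/2}$. For $\alpha>0$, $H^{\alpha,\square}(\mathbb{T}^d)$ is the (isotropic, periodic) Sobolev space of all $f\in L_2(\mathbb{T}^d)$ with finite norm, where the norms are $$\|f\|_{H^{\alpha,+}(\mathbb{T}^d)}:=\Big[\sum_{k\in\mathbb{Z}^d}|c_k(f)|^2\Big(1+\sum_{j=1}^d|k_j|^2\Big)^{\alpha}\Big]^{1/2},$$ $$\|f\|_{H^{\alpha,*}(\mathbb{T}^d)}:=\Big[\sum_{k\in\mathbb{Z}^d}|c_k(f)|^2\Big(1+\sum_{j=1}^d|k_j|^{2\alpha}\Big)\Big]^{1/2},$$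 $$\|f\|_{H^{\alpha,\sharp}(\mathbb{T}^d)}:=\Big[\sum_{k\in\mathbb{Z}^d}|c_k(f)|^2\Big(1+\sum_{j=1}^d|k_j|\Big)^{2\alpha}\Big]^{1/2}.$$ Information complexity. For $n\in\mathbb{N}_0$, $e^{\alpha,\square}(n,d)$ is the infimum, over all linear algorithms $A$ using at most $n$ continuous linear functionals (equivalently, linear operators of rank at most $n$), of $\sup_{\|f\|_{H^{\alpha,\square}(\mathbb{T}^d)}\le1}\|f-Af\|_{L_2(\mathbb{T}^d)}$. The information complexity is $n^{\alpha,\square}(\epsilon,\mathrm{id}_d):=\min\{n\in\mathbb{N}_0: e^{\alpha,\square}(n,d)\le\epsilon\}$. The initial error $e^{\alpha,\square}(0,d)$ equals $1$ for all $d$, so the absolute and normalized error criteria coincide. Tractability notions. For fixed $s,t\ge0$, the problem is $(s,t)$-weakly tractable if $$\lim_{\epsilon^{-1}+d\to\infty}\frac{\ln n^{\alpha,\square}(\epsilon,\mathrm{id}_d)}{\epsilon^{-s}+d^{t}}=0,$$ where the limit is taken along all sequences $((\epsilon_k,d_k))_{k\in\mathbb{N}}\subset(0,1)\times\mathbb{N}$ with $\epsilon_k^{-1}+d_k\to\infty$. The problem is weakly tractable if it is $(1,1)$-weakly tractable, and uniformly weakly tractable if it is $(s,t)$-weakly tractable for all $s,t>0$. *)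

theory Defs
  imports "HOL-Analysis.Analysis"
begin

(* The dimension d varies inside the statement, so points of R^d are functions nat => real
   restricted to {..<d}, and functions on the torus have type (nat => real) => complex.
   They are not quotiented by a.e. equality: every norm below depends only on Fourier
   coefficients, so a functional that is linear and continuous for such a norm
   agrees on a.e. equal representatives. *)

definition torus :: "nat \<Rightarrow> (nat \<Rightarrow> real) measure" where
  "torus d = PiM {..<d} (\<lambda>_. restrict_space lborel {0..2*pi})"

definition L2 :: "nat \<Rightarrow> ((nat \<Rightarrow> real) \<Rightarrow> complex) set" where
  "L2 d = {f \<in> borel_measurable (torus d). integrable (torus d) (\<lambda>x. (cmod (f x))\<^sup>2)}"

definition frequencies :: "nat \<Rightarrow> (nat \<Rightarrow> int) set" where
  "frequencies d = ({..<d} \<rightarrow>\<^sub>E UNIV)"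

definition fourier_coeff :: "nat \<Rightarrow> ((nat \<Rightarrow> real) \<Rightarrow> complex) \<Rightarrow> (nat \<Rightarrow> int) \<Rightarrow> complex" where
  "fourier_coeff d f k = complex_of_real ((2*pi) powr (- real d / 2)) *
     (LINT x|torus d. f x * exp (- \<i> * complex_of_real (\<Sum>j<d. real_of_int (k j) * x j)))"

(* The series converges for every f in L2 d (Bessel), so the value 0 that infsum assigns to
   divergent series plays no role for the functions to which this norm is applied. *)
definition L2_norm :: "nat \<Rightarrow> ((nat \<Rightarrow> real) \<Rightarrow> complex) \<Rightarrow> real" where
  "L2_norm d f = sqrt (\<Sum>\<^sub>\<infinity>k\<in>frequencies d. (cmod (fourier_coeff d f k))\<^sup>2)"

datatype norm_kind = Norm_plus | Norm_star | Norm_sharp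

fun sobolev_weight :: "real \<Rightarrow> norm_kind \<Rightarrow> nat \<Rightarrow> (nat \<Rightarrow> int) \<Rightarrow> real" where
  "sobolev_weight \<alpha> Norm_plus d k = (1 + (\<Sum>j<d. \<bar>real_of_int (k j)\<bar>\<^sup>2)) powr \<alpha>"
| "sobolev_weight \<alpha> Norm_star d k = 1 + (\<Sum>j<d. \<bar>real_of_int (k j)\<bar> powr (2 * \<alpha>))"
| "sobolev_weight \<alpha> Norm_sharp d k = (1 + (\<Sum>j<d. \<bar>real_of_int (k j)\<bar>)) powr (2 * \<alpha>)"

(* Finiteness of the norm is summability of the nonnegative series defining it. *)
definition sobolev :: "real \<Rightarrow> norm_kind \<Rightarrow> nat \<Rightarrow> ((nat \<Rightarrow> real) \<Rightarrow> complex) set" where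
  "sobolev \<alpha> sq d = {f \<in> L2 d.
     (\<lambda>k. (cmod (fourier_coeff d f k))\<^sup>2 * sobolev_weight \<alpha> sq d k) summable_on frequencies d}"

definition sobolev_norm ::
    "real \<Rightarrow> norm_kind \<Rightarrow> nat \<Rightarrow> ((nat \<Rightarrow> real) \<Rightarrow> complex) \<Rightarrow> real" where
  "sobolev_norm \<alpha> sq d f =
     sqrt (\<Sum>\<^sub>\<infinity>k\<in>frequencies d. (cmod (fourier_coeff d f k))\<^sup>2 * sobolev_weight \<alpha> sq d k)"

definition continuous_linear_functional ::
    "real \<Rightarrow> norm_kind \<Rightarrow> nat \<Rightarrow> (((nat \<Rightarrow> real) \<Rightarrow> complex) \<Rightarrow> complex) \<Rightarrow> bool" where
  "continuous_linear_functional \<alpha> sq d L \<longleftrightarrow>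
     (\<forall>f\<in>sobolev \<alpha> sq d. \<forall>g\<in>sobolev \<alpha> sq d. L (\<lambda>x. f x + g x) = L f + L g) \<and>
     (\<forall>c. \<forall>f\<in>sobolev \<alpha> sq d. L (\<lambda>x. c * f x) = c * L f) \<and>
     (\<forall>f\<in>sobolev \<alpha> sq d. \<forall>e>0. \<exists>\<delta>>0. \<forall>g\<in>sobolev \<alpha> sq d.
        sobolev_norm \<alpha> sq d (\<lambda>x. g x - f x) < \<delta> \<longrightarrow> cmod (L g - L f) < e)"

(* Fewer than n functionals are covered by taking some of the g i to be zero. *)
definition linear_algorithms ::
    "real \<Rightarrow> norm_kind \<Rightarrow> nat \<Rightarrow> nat \<Rightarrow>
     (((nat \<Rightarrow> real) \<Rightarrow> complex) \<Rightarrow> ((nat \<Rightarrow> real) \<Rightarrow> complex)) set" where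
  "linear_algorithms \<alpha> sq n d = {\<lambda>f x. \<Sum>i<n. L i f * g i x | L g.
     (\<forall>i<n. continuous_linear_functional \<alpha> sq d (L i)) \<and> (\<forall>i<n. g i \<in> L2 d)}"

(* Infimum and supremum are taken in the complete lattice [0, infinity]. *)
definition minimal_error :: "real \<Rightarrow> norm_kind \<Rightarrow> nat \<Rightarrow> nat \<Rightarrow> ennreal" where
  "minimal_error \<alpha> sq n d =
     (INF A \<in> linear_algorithms \<alpha> sq n d.
        SUP f \<in> {f \<in> sobolev \<alpha> sq d. sobolev_norm \<alpha> sq d f \<le> 1}.
          ennreal (L2_norm d (\<lambda>x. f x - A f x)))"

definition information_complexity :: "real \<Rightarrow> norm_kind \<Rightarrow> real \<Rightarrow> nat \<Rightarrow> nat" where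
  "information_complexity \<alpha> sq \<epsilon> d = (LEAST n. minimal_error \<alpha> sq n d \<le> ennreal \<epsilon>)"

definition st_weakly_tractable :: "real \<Rightarrow> norm_kind \<Rightarrow> real \<Rightarrow> real \<Rightarrow> bool" where
  "st_weakly_tractable \<alpha> sq s t \<longleftrightarrow>
     (\<forall>(\<epsilon> :: nat \<Rightarrow> real) (d :: nat \<Rightarrow> nat).
        (\<forall>i. 0 < \<epsilon> i \<and> \<epsilon> i < 1 \<and> 1 \<le> d i) \<longrightarrow>
        filterlim (\<lambda>i. inverse (\<epsilon> i) + real (d i)) at_top sequentially \<longrightarrow>
        (\<lambda>i. ln (real (information_complexity \<alpha> sq (\<epsilon> i) (d i))) /
              (\<epsilon> i powr (- s) + real (d i) powr t)) \<longlonglongrightarrow> 0)"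

definition weakly_tractable :: "real \<Rightarrow> norm_kind \<Rightarrow> bool" where
  "weakly_tractable \<alpha> sq \<longleftrightarrow> st_weakly_tractable \<alpha> sq 1 1"

definition uniformly_weakly_tractable :: "real \<Rightarrow> norm_kind \<Rightarrow> bool" where
  "uniformly_weakly_tractable \<alpha> sq \<longleftrightarrow> (\<forall>s>0. \<forall>t>0. st_weakly_tractable \<alpha> sq s t)"

end

theory Submission
  imports Defs
begin

text \<open>
  The embedding of a Sobolev space into \<open>L2\<close> is diagonal with respect to the characters of the torus:
  its singular values are \<open>1 / sqrt w\<close>, where \<open>w\<close> runs through the weights of the frequencies
  \<open>k\<close>.  Therefore the information complexity for accuracy \<open>\<epsilon>\<close> is the number of frequencies
  with \<open>\<epsilon>\<^sup>2 * w < 1\<close> (\<open>information_complexity_eq_card\<close>).  Truncating the Fourier series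
  shows that this many functionals suffice; with fewer functionals some trigonometric polynomial in
  these frequencies is annihilated by all of them and cannot be distinguished from zero.

  What remains is to count lattice points.

  For tractability, suppose that all low frequencies satisfy
  \<open>\<bar>k 0\<bar> + \<dots> + \<bar>k (d - 1)\<bar> \<le> \<epsilon> powr (- p)\<close>.  This holds with \<open>p = 1 / \<alpha>\<close> for the
  norm \<open>\<sharp>\<close> and, since \<open>\<bar>z\<bar> \<le> z\<^sup>2\<close> for integers, with \<open>p = 2 / \<alpha>\<close> for the norm
  \<open>+\<close>.  For every \<open>q\<close> strictly between 0 and 1, the number of such points is at most
  \<open>q powr (- (\<epsilon> powr (- p))) * ((1 + q) / (1 - q)) ^ d\<close> (\<open>card_simplex_le\<close>).  Its
  logarithm is a multiple of \<open>\<epsilon> powr (- p)\<close>, which is sublinear in \<open>inverse \<epsilon>\<close> when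
  \<open>p < 1\<close>, plus \<open>d\<close> times a constant that a small \<open>q\<close> makes as small as desired
  (\<open>weakly_tractable_if_simplex\<close>).

  Against tractability, the weights on the \<open>3 ^ d\<close> points with all components in \<open>{-1, 0, 1}\<close> are
  at most \<open>(1 + d) powr (2 * \<beta>)\<close>, with \<open>\<beta>\<close> equal to \<open>\<alpha> / 2\<close>, \<open>1 / 2\<close> and \<open>\<alpha>\<close> for the
  norms \<open>+\<close>, \<open>*\<close> and \<open>\<sharp>\<close>.  Accuracy \<open>(d + 2) powr (- \<beta>)\<close> thus costs at least
  \<open>3 ^ d\<close> functionals, which refutes \<open>(s, t)\<close>-weak tractability whenever \<open>\<beta> * s \<le> 1\<close> and
  \<open>t \<le> 1\<close> (\<open>not_st_weakly_tractable\<close>).  With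
  \<open>s = t = 1\<close> this rules out weak tractability for \<open>\<alpha> \<le> 2\<close> (norm \<open>+\<close>), for \<open>\<alpha> \<le> 1\<close>
  (norm \<open>\<sharp>\<close>) and for every \<open>\<alpha>\<close> (norm \<open>*\<close>); with \<open>s = 1 / \<beta>\<close> and \<open>t = 1\<close> it
  rules out uniform weak tractability in all three cases.
\<close>

section \<open>Characters of the torus\<close>

definition torus_exp :: "nat \<Rightarrow> (nat \<Rightarrow> int) \<Rightarrow> (nat \<Rightarrow> real) \<Rightarrow> complex" where
  "torus_exp d k x = complex_of_real ((2*pi) powr (- real d / 2)) *
     exp (\<i> * complex_of_real (\<Sum>j<d. real_of_int (k j) * x j))"

abbreviation circle :: "real measure" where
  "circle \<equiv> restrict_space lborel {0..2*pi}"

lemma space_circle: "space circle = {0..2*pi}"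
  by (simp add: space_restrict_space)

lemma emeasure_circle: "emeasure circle {0..2*pi} = ennreal (2 * pi)"
  by (simp add: emeasure_restrict_space)

lemma finite_measure_circle: "finite_measure circle"
  by standard (simp add: space_circle emeasure_circle)

lemma product_sigma_finite_circle: "product_sigma_finite (\<lambda>_. circle)"
  using finite_measure_circle unfolding product_sigma_finite_def
  by (simp add: finite_measure.axioms(1))

lemma finite_measure_torus: "finite_measure (torus d)"
proof
  interpret product_sigma_finite "\<lambda>_::nat. circle" by (rule product_sigma_finite_circle)
  have "emeasure (torus d) (space (torus d)) = (\<Prod>i<d. ennreal (2 * pi))"
    unfolding torus_def space_PiM space_circle
    by (subst emeasure_PiM) (simp_all add: emeasure_circle sets_restrict_space_iff)
  then show "emeasure (torus d) (space (torus d)) \<noteq> \<infinity>"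
    by (simp add: ennreal_power)
qed

lemma measurable_torus_component [measurable]:
  "j < d \<Longrightarrow> (\<lambda>x. x j) \<in> borel_measurable (torus d)"
  unfolding torus_def
  by (rule measurable_compose[OF measurable_component_singleton])
     (auto intro: measurable_restrict_space1)

lemma measurable_torus_sum [measurable]:
  "(\<lambda>x. \<Sum>j<d. real_of_int (k j) * x j) \<in> borel_measurable (torus d)"
  by (rule borel_measurable_sum) (auto intro!: borel_measurable_times measurable_torus_component)

lemma measurable_torus_character:
  "(\<lambda>x. exp (c * complex_of_real (\<Sum>j<d. real_of_int (k j) * x j))) \<in> borel_measurable (torus d)"
  by (measurable; simp add: measurable_torus_sum)

lemma cmod_character:
  "cmod (exp (\<i> * complex_of_real r)) = 1" "cmod (exp (- \<i> * complex_of_real r)) = 1"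
  by (simp_all add: norm_exp_i_times exp_minus norm_inverse)

lemma measurable_torus_exp [measurable]: "torus_exp d k \<in> borel_measurable (torus d)"
  unfolding torus_exp_def[abs_def] by (intro borel_measurable_times measurable_torus_character) auto

lemma integral_circle_character:
  "(LINT x|circle. exp (\<i> * complex_of_real (real_of_int m * x))) =
     (if m = 0 then complex_of_real (2 * pi) else 0)"
proof (cases "m = 0")
  case True
  then show ?thesis
    by (simp add: measure_def space_circle emeasure_circle scaleR_conv_of_real)
next
  case False
  \<comment> \<open>An antiderivative; it takes the same value at both ends of the period.\<close>
  define F where "F x = exp (\<i> * complex_of_real (real_of_int m * x)) / (\<i> * of_int m)" for x
  have "(LINT x|circle. exp (\<i> * complex_of_real (real_of_int m * x)))
        = (LINT x|lborel. indicator {0..2*pi} x *\<^sub>R exp (\<i> * complex_of_real (real_of_int m * x)))"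
    by (subst integral_restrict_space) auto
  also have "\<dots> = F (2 * pi) - F 0"
  proof (rule integral_FTC_Icc)
    fix x :: real
    have "((\<lambda>z. exp (\<i> * (of_int m * z)) / (\<i> * of_int m)) has_field_derivative
            exp (\<i> * (of_int m * complex_of_real x))) (at (complex_of_real x))"
      using False by (auto intro!: derivative_eq_intros simp: mult_ac)
    from has_vector_derivative_real_field[OF this]
    show "(F has_vector_derivative exp (\<i> * complex_of_real (real_of_int m * x)))
            (at x within {0..2*pi})"
      by (simp add: F_def[abs_def])
  qed (auto intro!: continuous_intros)
  also have "F (2 * pi) = F 0"
  proof -
    have "exp (complex_of_real (2 * real_of_int m * pi) * \<i>) = 1"
      by (rule exp_integer_2pi) simp
    then show ?thesis by (simp add: F_def mult_ac)
  qed
  finally show ?thesis using False by simp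
qed

lemma integral_torus_character:
  "(LINT x|torus d. exp (\<i> * complex_of_real (\<Sum>j<d. real_of_int (k j) * x j))) =
     (if \<forall>j<d. k j = 0 then complex_of_real ((2*pi) ^ d) else 0)"
proof -
  interpret product_sigma_finite "\<lambda>_::nat. circle" by (rule product_sigma_finite_circle)
  interpret finite_measure circle by (rule finite_measure_circle)
  have "(LINT x|torus d. exp (\<i> * complex_of_real (\<Sum>j<d. real_of_int (k j) * x j))) =
    (LINT x|torus d. (\<Prod>j<d. exp (\<i> * complex_of_real (real_of_int (k j) * x j))))"
    by (simp add: exp_sum[symmetric] sum_distrib_left)
  also have "\<dots> = (\<Prod>j<d. (LINT t|circle. exp (\<i> * complex_of_real (real_of_int (k j) * t))))"
    unfolding torus_def
  proof (rule product_integral_prod)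
    fix j assume "j \<in> {..<d}"
    show "integrable circle (\<lambda>t. exp (\<i> * complex_of_real (real_of_int (k j) * t)))"
      by (rule integrable_const_bound[where B=1])
         (auto simp: cmod_character intro!: measurable_restrict_space1)
  qed auto
  also have "\<dots> = (\<Prod>j<d. if k j = 0 then complex_of_real (2 * pi) else 0)"
    by (simp only: integral_circle_character)
  also have "\<dots> = (if \<forall>j<d. k j = 0 then complex_of_real ((2*pi) ^ d) else 0)"
    by auto
  finally show ?thesis .
qed

lemma torus_exp_mult_character:
  "torus_exp d m x * exp (- \<i> * complex_of_real (\<Sum>j<d. real_of_int (k j) * x j)) =
     complex_of_real ((2*pi) powr (- real d / 2)) *
     exp (\<i> * complex_of_real (\<Sum>j<d. real_of_int (m j - k j) * x j))"
  by (simp add: torus_exp_def exp_add[symmetric] sum_subtractf algebra_simps)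

text \<open>
  Orthonormality of the characters.  The factor \<open>(2 * pi) powr (- d / 2)\<close> appears once in the
  coefficient and once in the character; together they cancel the volume of the torus.
\<close>

lemma fourier_coeff_torus_exp:
  assumes "k \<in> frequencies d" "m \<in> frequencies d"
  shows "fourier_coeff d (torus_exp d m) k = (if k = m then 1 else 0)"
proof -
  have "(\<forall>j<d. m j - k j = 0) \<longleftrightarrow> k = m"
    using assms unfolding frequencies_def by (auto intro: PiE_ext[of _ "{..<d}" "\<lambda>_. UNIV"])
  moreover have "a powr (- real d / 2) * (a powr (- real d / 2) * a ^ d) = 1" if "a > 0" for a :: real
    using that by (simp add: powr_realpow[symmetric] powr_add[symmetric])
  from this[of "2 * pi"] have "(2*pi) powr (- real d / 2) * ((2*pi) powr (- real d / 2) * (2*pi) ^ d) = 1"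
    by simp
  then have "complex_of_real ((2*pi) powr (- real d / 2)) *
      (complex_of_real ((2*pi) powr (- real d / 2)) * complex_of_real ((2*pi) ^ d)) = 1"
    by (metis of_real_1 of_real_mult)
  ultimately show ?thesis
    unfolding fourier_coeff_def torus_exp_mult_character integral_mult_right_zero
      integral_torus_character by simp
qed

section \<open>Linearity of the Fourier coefficients\<close>

lemma torus_exp_L2: "torus_exp d k \<in> L2 d"
proof -
  have "(cmod (torus_exp d k x))\<^sup>2 = ((2*pi) powr (- real d / 2))\<^sup>2" for x
    by (simp add: torus_exp_def norm_mult cmod_character del: of_real_sum)
  then show ?thesis
    using finite_measure.integrable_const[OF finite_measure_torus]
    by (simp add: L2_def measurable_torus_exp)
qed

lemma L2_zero: "(\<lambda>x. 0) \<in> L2 d"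
  by (simp add: L2_def)

lemma L2_scale:
  assumes "f \<in> L2 d"
  shows "(\<lambda>x. c * f x) \<in> L2 d"
  using assms by (auto simp: L2_def norm_mult power_mult_distrib)

lemma cmod_add_square_le: "(cmod (a + b))\<^sup>2 \<le> 2 * (cmod a)\<^sup>2 + 2 * (cmod b)\<^sup>2"
proof -
  have "(cmod (a + b))\<^sup>2 \<le> (cmod a + cmod b)\<^sup>2"
    by (intro power_mono norm_triangle_ineq) simp
  also have "\<dots> \<le> 2 * (cmod a)\<^sup>2 + 2 * (cmod b)\<^sup>2"
    using zero_le_power2[of "cmod a - cmod b"] by (simp add: power2_eq_square algebra_simps)
  finally show ?thesis .
qed

lemma L2_add:
  assumes "f \<in> L2 d" "g \<in> L2 d"
  shows "(\<lambda>x. f x + g x) \<in> L2 d"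
proof -
  have meas: "f \<in> borel_measurable (torus d)" "g \<in> borel_measurable (torus d)"
    using assms by (auto simp: L2_def)
  have "integrable (torus d) (\<lambda>x. (cmod (f x + g x))\<^sup>2)"
  proof (rule Bochner_Integration.integrable_bound)
    show "integrable (torus d) (\<lambda>x. 2 * (cmod (f x))\<^sup>2 + 2 * (cmod (g x))\<^sup>2)"
      using assms by (auto simp: L2_def)
  qed (use meas cmod_add_square_le in auto)
  then show ?thesis using meas by (auto simp: L2_def)
qed

lemma L2_sum:
  assumes "\<And>i. i \<in> I \<Longrightarrow> f i \<in> L2 d"
  shows "(\<lambda>x. \<Sum>i\<in>I. f i x) \<in> L2 d"
  using assms by (induction I rule: infinite_finite_induct) (auto intro: L2_zero L2_add)

text \<open>
  On a finite measure space square integrability implies integrability, through the pointwise bound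
  \<open>t \<le> 1 + t\<^sup>2\<close>.  This is what makes the Fourier coefficients additive on \<open>L2\<close>.
\<close>

lemma integrable_L2_character:
  assumes "f \<in> L2 d"
  shows "integrable (torus d) (\<lambda>x. f x * exp (- \<i> * complex_of_real (\<Sum>j<d. real_of_int (k j) * x j)))"
proof (rule Bochner_Integration.integrable_bound)
  show "integrable (torus d) (\<lambda>x. 1 + (cmod (f x))\<^sup>2)"
    using assms finite_measure.integrable_const[OF finite_measure_torus, of d "1::real"]
    by (auto simp: L2_def)
  show "(\<lambda>x. f x * exp (- \<i> * complex_of_real (\<Sum>j<d. real_of_int (k j) * x j)))
    \<in> borel_measurable (torus d)"
    using assms by (intro borel_measurable_times measurable_torus_character) (auto simp: L2_def)
  have "cmod z \<le> 1 + (cmod z)\<^sup>2" for z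
  proof -
    have "2 * cmod z \<le> (cmod z)\<^sup>2 + 1"
      using zero_le_power2[of "cmod z - 1"] by (simp add: power2_diff)
    then show ?thesis using norm_ge_zero[of z] by linarith
  qed
  then show "AE x in torus d. norm (f x * exp (- \<i> * complex_of_real (\<Sum>j<d. real_of_int (k j) * x j)))
      \<le> norm (1 + (cmod (f x))\<^sup>2)"
    by (simp only: norm_mult cmod_character) simp
qed

lemma fourier_coeff_add:
  assumes "f \<in> L2 d" "g \<in> L2 d"
  shows "fourier_coeff d (\<lambda>x. f x + g x) k = fourier_coeff d f k + fourier_coeff d g k"
  unfolding fourier_coeff_def distrib_right
  by (simp only: Bochner_Integration.integral_add[OF integrable_L2_character[OF assms(1)]
        integrable_L2_character[OF assms(2)]] distrib_left)

lemma fourier_coeff_scale: "fourier_coeff d (\<lambda>x. c * f x) k = c * fourier_coeff d f k"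
  unfolding fourier_coeff_def by (simp add: mult.assoc del: of_real_sum)

lemma fourier_coeff_sum:
  assumes "\<And>i. i \<in> I \<Longrightarrow> f i \<in> L2 d"
  shows "fourier_coeff d (\<lambda>x. \<Sum>i\<in>I. f i x) k = (\<Sum>i\<in>I. fourier_coeff d (f i) k)"
  using assms
proof (induction I rule: infinite_finite_induct)
  case (insert i I)
  then show ?case by (simp add: fourier_coeff_add L2_sum)
qed (simp_all add: fourier_coeff_def)

lemma fourier_coeff_diff:
  assumes "f \<in> L2 d" "g \<in> L2 d"
  shows "fourier_coeff d (\<lambda>x. f x - g x) k = fourier_coeff d f k - fourier_coeff d g k"
  using fourier_coeff_add[OF assms(1) L2_scale[OF assms(2), of "-1"]]
    fourier_coeff_scale[of d "-1" g k] by simp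

lemma fourier_coeff_trig_poly:
  assumes "finite K" "K \<subseteq> frequencies d" "k \<in> frequencies d"
  shows "fourier_coeff d (\<lambda>x. \<Sum>m\<in>K. c m * torus_exp d m x) k = (if k \<in> K then c k else 0)"
proof -
  have "fourier_coeff d (\<lambda>x. \<Sum>m\<in>K. c m * torus_exp d m x) k =
      (\<Sum>m\<in>K. fourier_coeff d (\<lambda>x. c m * torus_exp d m x) k)"
    by (rule fourier_coeff_sum) (intro L2_scale torus_exp_L2)
  also have "\<dots> = (\<Sum>m\<in>K. if k = m then c m else 0)"
    using assms by (intro sum.cong) (auto simp: fourier_coeff_scale fourier_coeff_torus_exp subset_iff)
  also have "\<dots> = (if k \<in> K then c k else 0)"
    using assms(1) by simp
  finally show ?thesis .
qed

section \<open>Trigonometric polynomials in the Sobolev spaces\<close>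

lemma sobolev_weight_ge_1:
  assumes "\<alpha> > 0"
  shows "sobolev_weight \<alpha> sq d k \<ge> 1"
  using assms by (cases sq) (auto intro!: ge_one_powr_ge_zero sum_nonneg)

lemma sobolev_add:
  assumes "\<alpha> > 0" "f \<in> sobolev \<alpha> sq d" "g \<in> sobolev \<alpha> sq d"
  shows "(\<lambda>x. f x + g x) \<in> sobolev \<alpha> sq d"
proof -
  have L2: "f \<in> L2 d" "g \<in> L2 d" using assms by (auto simp: sobolev_def)
  have "(\<lambda>k. 2 * ((cmod (fourier_coeff d f k))\<^sup>2 * sobolev_weight \<alpha> sq d k) +
         2 * ((cmod (fourier_coeff d g k))\<^sup>2 * sobolev_weight \<alpha> sq d k)) summable_on frequencies d"
    using assms by (intro summable_on_add summable_on_cmult_right) (auto simp: sobolev_def)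
  then have "(\<lambda>k. (cmod (fourier_coeff d (\<lambda>x. f x + g x) k))\<^sup>2 * sobolev_weight \<alpha> sq d k)
      summable_on frequencies d"
  proof (rule summable_on_comparison_test)
    fix k
    have w: "0 \<le> sobolev_weight \<alpha> sq d k" using sobolev_weight_ge_1[OF assms(1), of sq d k] by simp
    then show "(cmod (fourier_coeff d (\<lambda>x. f x + g x) k))\<^sup>2 * sobolev_weight \<alpha> sq d k \<le>
        2 * ((cmod (fourier_coeff d f k))\<^sup>2 * sobolev_weight \<alpha> sq d k) +
         2 * ((cmod (fourier_coeff d g k))\<^sup>2 * sobolev_weight \<alpha> sq d k)"
      using mult_right_mono[OF cmod_add_square_le w, of "fourier_coeff d f k" "fourier_coeff d g k"]
      by (simp add: fourier_coeff_add L2 algebra_simps)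
    show "0 \<le> (cmod (fourier_coeff d (\<lambda>x. f x + g x) k))\<^sup>2 * sobolev_weight \<alpha> sq d k"
      using w by simp
  qed
  then show ?thesis using L2 by (simp add: sobolev_def L2_add)
qed

lemma sobolev_scale:
  assumes "f \<in> sobolev \<alpha> sq d"
  shows "(\<lambda>x. c * f x) \<in> sobolev \<alpha> sq d"
  using assms
  by (auto simp: sobolev_def L2_scale fourier_coeff_scale norm_mult power_mult_distrib mult.assoc
           intro: summable_on_cmult_right)

lemma sobolev_diff:
  assumes "\<alpha> > 0" "f \<in> sobolev \<alpha> sq d" "g \<in> sobolev \<alpha> sq d"
  shows "(\<lambda>x. f x - g x) \<in> sobolev \<alpha> sq d"
  using sobolev_add[OF assms(1,2) sobolev_scale[OF assms(3), of "-1"]] by simp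

text \<open>
  On trigonometric polynomials the norms are finite weighted sums, so the lower bound on the error
  can be tested on them by finite-dimensional linear algebra.
\<close>

lemma trig_poly_norms:
  fixes c :: "(nat \<Rightarrow> int) \<Rightarrow> complex"
  assumes "\<alpha> > 0" "finite K" "K \<subseteq> frequencies d"
  defines "f \<equiv> \<lambda>x. \<Sum>m\<in>K. c m * torus_exp d m x"
  shows trig_poly_sobolev: "f \<in> sobolev \<alpha> sq d"
    and sobolev_norm_trig_poly:
      "(sobolev_norm \<alpha> sq d f)\<^sup>2 = (\<Sum>k\<in>K. (cmod (c k))\<^sup>2 * sobolev_weight \<alpha> sq d k)"
    and L2_norm_trig_poly: "(L2_norm d f)\<^sup>2 = (\<Sum>k\<in>K. (cmod (c k))\<^sup>2)"
proof -
  note coeff = fourier_coeff_trig_poly[OF assms(2,3), of _ c, folded f_def]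
  have "f \<in> L2 d" unfolding f_def by (intro L2_sum L2_scale torus_exp_L2)
  moreover have "(\<lambda>k. (cmod (fourier_coeff d f k))\<^sup>2 * sobolev_weight \<alpha> sq d k) summable_on frequencies d
      \<longleftrightarrow> (\<lambda>k. (cmod (c k))\<^sup>2 * sobolev_weight \<alpha> sq d k) summable_on K"
    by (rule summable_on_cong_neutral) (use coeff assms(3) in auto)
  ultimately show "f \<in> sobolev \<alpha> sq d"
    using assms(2) by (simp add: sobolev_def)
  have "(\<Sum>\<^sub>\<infinity>k\<in>frequencies d. (cmod (fourier_coeff d f k))\<^sup>2 * sobolev_weight \<alpha> sq d k) =
      (\<Sum>\<^sub>\<infinity>k\<in>K. (cmod (c k))\<^sup>2 * sobolev_weight \<alpha> sq d k)"
    by (rule infsum_cong_neutral) (use coeff assms(3) in auto)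
  moreover have "0 \<le> sobolev_weight \<alpha> sq d k" for k
    using sobolev_weight_ge_1[OF assms(1), of sq d k] by simp
  ultimately show "(sobolev_norm \<alpha> sq d f)\<^sup>2 = (\<Sum>k\<in>K. (cmod (c k))\<^sup>2 * sobolev_weight \<alpha> sq d k)"
    using assms(2) by (simp add: sobolev_norm_def sum_nonneg)
  have "(\<Sum>\<^sub>\<infinity>k\<in>frequencies d. (cmod (fourier_coeff d f k))\<^sup>2) = (\<Sum>\<^sub>\<infinity>k\<in>K. (cmod (c k))\<^sup>2)"
    by (rule infsum_cong_neutral) (use coeff assms(3) in auto)
  then show "(L2_norm d f)\<^sup>2 = (\<Sum>k\<in>K. (cmod (c k))\<^sup>2)"
    using assms(2) by (simp add: L2_norm_def sum_nonneg)
qed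

section \<open>The information complexity as a number of lattice points\<close>

text \<open>
  The embedding into \<open>L2\<close> is diagonal in the characters, with singular values
  \<open>1 / sqrt (sobolev_weight \<alpha> sq d k)\<close>; these are the frequencies whose singular value exceeds
  \<open>\<epsilon>\<close>.
\<close>

definition low_frequencies :: "real \<Rightarrow> norm_kind \<Rightarrow> real \<Rightarrow> nat \<Rightarrow> (nat \<Rightarrow> int) set" where
  "low_frequencies \<alpha> sq \<epsilon> d = {k \<in> frequencies d. \<epsilon>\<^sup>2 * sobolev_weight \<alpha> sq d k < 1}"

text \<open>
  Because all weights are at least \<open>1\<close>, each coefficient is a functional of norm at most \<open>1\<close>; this
  makes the Fourier coefficients admissible information.
\<close>

lemma cmod_fourier_coeff_le_sobolev_norm:
  assumes "\<alpha> > 0" "f \<in> sobolev \<alpha> sq d" "k \<in> frequencies d"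
  shows "cmod (fourier_coeff d f k) \<le> sobolev_norm \<alpha> sq d f"
proof -
  let ?t = "\<lambda>k. (cmod (fourier_coeff d f k))\<^sup>2 * sobolev_weight \<alpha> sq d k"
  have w: "1 \<le> sobolev_weight \<alpha> sq d k" for k
    by (rule sobolev_weight_ge_1[OF assms(1)])
  have "(cmod (fourier_coeff d f k))\<^sup>2 \<le> ?t k"
    using mult_left_mono[OF w, of "(cmod (fourier_coeff d f k))\<^sup>2" k] by simp
  also have "\<dots> = sum ?t {k}" by simp
  also have "\<dots> \<le> infsum ?t (frequencies d)"
  proof (rule finite_sum_le_infsum)
    show "0 \<le> ?t x" for x using w[of x] by simp
  qed (use assms in \<open>auto simp: sobolev_def\<close>)
  finally show ?thesis
    unfolding sobolev_norm_def by (rule real_le_rsqrt)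
qed

lemma fourier_coeff_continuous_linear_functional:
  assumes "\<alpha> > 0" "k \<in> frequencies d"
  shows "continuous_linear_functional \<alpha> sq d (\<lambda>f. fourier_coeff d f k)"
proof -
  have "cmod (fourier_coeff d g k - fourier_coeff d f k) \<le> sobolev_norm \<alpha> sq d (\<lambda>x. g x - f x)"
    if "f \<in> sobolev \<alpha> sq d" "g \<in> sobolev \<alpha> sq d" for f g
    using cmod_fourier_coeff_le_sobolev_norm[OF assms(1) sobolev_diff[OF assms(1) that(2,1)] assms(2)] that
    by (simp add: fourier_coeff_diff sobolev_def)
  then have "\<exists>\<delta>>0. \<forall>g\<in>sobolev \<alpha> sq d. sobolev_norm \<alpha> sq d (\<lambda>x. g x - f x) < \<delta> \<longrightarrow>
      cmod (fourier_coeff d g k - fourier_coeff d f k) < e"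
    if "f \<in> sobolev \<alpha> sq d" "e > 0" for f e
    using that by (intro exI[of _ e]) (auto intro: le_less_trans)
  then show ?thesis
    unfolding continuous_linear_functional_def
    by (auto simp: fourier_coeff_add fourier_coeff_scale sobolev_def)
qed

text \<open>
  Counting dimensions: \<open>n\<close> linear equations in more than \<open>n\<close> unknowns have a nontrivial solution.
  The induction eliminates one unknown with the help of the last equation, unless that equation is
  trivial.
\<close>

lemma exists_annihilated_combination:
  fixes a :: "nat \<Rightarrow> 'k \<Rightarrow> 'a::field"
  assumes "finite K" "n < card K"
  shows "\<exists>c. (\<exists>k\<in>K. c k \<noteq> 0) \<and> (\<forall>i<n. (\<Sum>k\<in>K. c k * a i k) = 0)"
  using assms
proof (induction n arbitrary: K a)
  case 0
  then have "K \<noteq> {}" by auto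
  then show ?case by (intro exI[of _ "\<lambda>_. 1"]) auto
next
  case (Suc n)
  show ?case
  proof (cases "\<forall>k\<in>K. a n k = 0")
    case True
    obtain c where c: "\<exists>k\<in>K. c k \<noteq> 0" "\<forall>i<n. (\<Sum>k\<in>K. c k * a i k) = 0"
      using Suc.IH[of K a] Suc.prems by auto
    have "\<forall>i<Suc n. (\<Sum>k\<in>K. c k * a i k) = 0"
      using c(2) True by (auto simp: less_Suc_eq)
    then show ?thesis using c(1) by blast
  next
    case False
    then obtain k0 where k0: "k0 \<in> K" "a n k0 \<noteq> 0" by auto
    define K' where "K' = K - {k0}"
    \<comment> \<open>Each new column is an old one minus the multiple of column \<open>k0\<close> that clears equation \<open>n\<close>.\<close>
    define a' where "a' i k = a i k - a i k0 * a n k / a n k0" for i k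
    have K': "finite K'" "n < card K'" "k0 \<notin> K'" "K = insert k0 K'"
      using Suc.prems k0 by (auto simp: K'_def)
    obtain c where c: "\<exists>k\<in>K'. c k \<noteq> 0" "\<forall>i<n. (\<Sum>k\<in>K'. c k * a' i k) = 0"
      using Suc.IH[of K' a'] K' by auto
    define s where "s = (\<Sum>k\<in>K'. c k * a n k)"
    define c' where "c' = c(k0 := - s / a n k0)"
    have split: "(\<Sum>k\<in>K. c' k * a i k) = - s / a n k0 * a i k0 + (\<Sum>k\<in>K'. c k * a i k)" for i
    proof -
      have "(\<Sum>k\<in>K'. c' k * a i k) = (\<Sum>k\<in>K'. c k * a i k)"
        using K'(3) by (intro sum.cong) (auto simp: c'_def)
      then show ?thesis using K' by (simp add: c'_def)
    qed
    have "(\<Sum>k\<in>K. c' k * a i k) = 0" if "i < Suc n" for i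
    proof (cases "i = n")
      case True
      then show ?thesis using k0 by (simp add: split s_def)
    next
      case False
      then have "(\<Sum>k\<in>K'. c k * a' i k) = 0" using c(2) that by simp
      moreover have "(\<Sum>k\<in>K'. c k * a' i k) = (\<Sum>k\<in>K'. c k * a i k) - s / a n k0 * a i k0"
        unfolding a'_def s_def sum_divide_distrib sum_distrib_right sum_subtractf[symmetric]
        by (intro sum.cong) (simp_all add: algebra_simps)
      ultimately show ?thesis by (simp add: split)
    qed
    moreover have "\<exists>k\<in>K. c' k \<noteq> 0" using c(1) K' by (auto simp: c'_def)
    ultimately show ?thesis by blast
  qed
qed

lemma continuous_linear_functional_trig_poly:
  assumes "\<alpha> > 0" "continuous_linear_functional \<alpha> sq d L" "finite K" "K \<subseteq> frequencies d"
  shows "L (\<lambda>x. \<Sum>m\<in>K. c m * torus_exp d m x) = (\<Sum>m\<in>K. c m * L (torus_exp d m))"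
proof -
  have add: "L (\<lambda>x. f x + g x) = L f + L g" if "f \<in> sobolev \<alpha> sq d" "g \<in> sobolev \<alpha> sq d" for f g
    using assms(2) that unfolding continuous_linear_functional_def by blast
  have scale: "L (\<lambda>x. c * f x) = c * L f" if "f \<in> sobolev \<alpha> sq d" for c f
    using assms(2) that unfolding continuous_linear_functional_def by blast
  have mono: "torus_exp d m \<in> sobolev \<alpha> sq d" if "m \<in> frequencies d" for m
    using trig_poly_sobolev[OF assms(1), of "{m}" d "\<lambda>_. 1" sq] that by simp
  show ?thesis using assms(3,4)
  proof (induction K rule: finite_induct)
    case empty
    have "(\<lambda>x. 0) \<in> sobolev \<alpha> sq d"
      using trig_poly_sobolev[OF assms(1), of "{}" d "\<lambda>_. 0" sq] by simp
    from scale[OF this, of 0] show ?case by simp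
  next
    case (insert m K)
    have "(\<lambda>x. \<Sum>m\<in>K. c m * torus_exp d m x) \<in> sobolev \<alpha> sq d"
      using trig_poly_sobolev[OF assms(1), of K d c sq] insert by simp
    then show ?case
      using insert by (simp add: add scale mono sobolev_scale)
  qed
qed

text \<open>
  The optimal algorithm truncates the Fourier series to the low frequencies.  What remains of \<open>f\<close>
  lives on frequencies with \<open>\<epsilon>\<^sup>2 * sobolev_weight \<alpha> sq d k \<ge> 1\<close>, so its squared \<open>L2\<close> norm is
  at most \<open>\<epsilon>\<^sup>2\<close> times the squared Sobolev norm of \<open>f\<close>.
\<close>

lemma minimal_error_card_low_frequencies_le:
  assumes "\<alpha> > 0" "\<epsilon> > 0" "finite (low_frequencies \<alpha> sq \<epsilon> d)"
  shows "minimal_error \<alpha> sq (card (low_frequencies \<alpha> sq \<epsilon> d)) d \<le> ennreal \<epsilon>"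
proof -
  define K where "K = low_frequencies \<alpha> sq \<epsilon> d"
  have K: "finite K" "K \<subseteq> frequencies d"
    using assms(3) by (auto simp: K_def low_frequencies_def)
  obtain h where h: "bij_betw h {..<card K} K"
    using ex_bij_betw_nat_finite[OF K(1)] by (auto simp: atLeast0LessThan)
  define A where "A f x = (\<Sum>i<card K. fourier_coeff d f (h i) * torus_exp d (h i) x)" for f x
  have A_eq: "A f x = (\<Sum>m\<in>K. fourier_coeff d f m * torus_exp d m x)" for f x
    unfolding A_def by (rule sum.reindex_bij_betw[OF h])
  have h_mem: "h i \<in> frequencies d" if "i < card K" for i
    using h K(2) that by (auto simp: bij_betw_def)
  have A: "A \<in> linear_algorithms \<alpha> sq (card K) d"
    unfolding linear_algorithms_def A_def[abs_def] mem_Collect_eq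
    by (rule exI[of _ "\<lambda>i f. fourier_coeff d f (h i)"], rule exI[of _ "\<lambda>i. torus_exp d (h i)"])
       (auto simp: h_mem torus_exp_L2 intro!: fourier_coeff_continuous_linear_functional assms)
  have "L2_norm d (\<lambda>x. f x - A f x) \<le> \<epsilon>"
    if f: "f \<in> sobolev \<alpha> sq d" "sobolev_norm \<alpha> sq d f \<le> 1" for f
  proof -
    let ?t = "\<lambda>k. (cmod (fourier_coeff d f k))\<^sup>2 * sobolev_weight \<alpha> sq d k"
    let ?r = "\<lambda>k. (cmod (fourier_coeff d (\<lambda>x. f x - A f x) k))\<^sup>2"
    have fL2: "f \<in> L2 d" using f by (simp add: sobolev_def)
    have AL2: "A f \<in> L2 d"
      unfolding A_eq[abs_def] by (intro L2_sum L2_scale torus_exp_L2)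
    have coeff: "fourier_coeff d (\<lambda>x. f x - A f x) k = (if k \<in> K then 0 else fourier_coeff d f k)"
      if "k \<in> frequencies d" for k
      unfolding fourier_coeff_diff[OF fL2 AL2] unfolding A_eq[abs_def] fourier_coeff_trig_poly[OF K that]
      by simp
    have summable: "?t summable_on frequencies d" using f by (simp add: sobolev_def)
    have le: "?r k \<le> \<epsilon>\<^sup>2 * ?t k" if k: "k \<in> frequencies d" for k
    proof (cases "k \<in> K")
      case True
      then show ?thesis
        using coeff[OF k] sobolev_weight_ge_1[OF assms(1), of sq d k] by simp
    next
      case False
      then have "1 \<le> \<epsilon>\<^sup>2 * sobolev_weight \<alpha> sq d k"
        using k by (auto simp: K_def low_frequencies_def)
      from mult_left_mono[OF this, of "(cmod (fourier_coeff d f k))\<^sup>2"] show ?thesis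
        using coeff[OF k] False by (simp add: algebra_simps)
    qed
    have summable': "?r summable_on frequencies d"
      by (rule summable_on_comparison_test[OF summable_on_cmult_right[OF summable, of "\<epsilon>\<^sup>2"]])
         (use le in auto)
    have "infsum ?r (frequencies d) \<le> infsum (\<lambda>k. \<epsilon>\<^sup>2 * ?t k) (frequencies d)"
      by (rule infsum_mono[OF summable' summable_on_cmult_right[OF summable]]) (use le in auto)
    also have "\<dots> = \<epsilon>\<^sup>2 * infsum ?t (frequencies d)"
      by (rule infsum_cmult_right')
    also have "\<dots> \<le> \<epsilon>\<^sup>2 * 1"
      using f(2) by (intro mult_left_mono) (simp_all add: sobolev_norm_def)
    finally show ?thesis
      using assms(2) by (simp add: L2_norm_def real_le_lsqrt)
  qed
  then have "(SUP f \<in> {f \<in> sobolev \<alpha> sq d. sobolev_norm \<alpha> sq d f \<le> 1}.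
      ennreal (L2_norm d (\<lambda>x. f x - A f x))) \<le> ennreal \<epsilon>"
    by (intro SUP_least ennreal_leI) auto
  then show ?thesis
    unfolding minimal_error_def K_def[symmetric] by (rule INF_lower2[OF A])
qed

text \<open>
  Fooling functions: fewer than \<open>card K\<close> functionals all vanish on some trigonometric polynomial with
  frequencies in \<open>K\<close> and Sobolev norm \<open>1\<close>.  The algorithm maps it to zero, so the error is at least
  its \<open>L2\<close> norm, which is at least \<open>1 / sqrt W\<close> for the largest weight \<open>W\<close> on \<open>K\<close>.  Finiteness
  of \<open>K\<close> makes \<open>1 / sqrt W\<close> exceed \<open>\<epsilon>\<close> strictly, and by a margin independent of the algorithm, so
  the strict inequality survives the infimum over all algorithms.
\<close>

lemma minimal_error_gt:
  assumes "\<alpha> > 0" "\<epsilon> > 0" "K \<subseteq> low_frequencies \<alpha> sq \<epsilon> d" "finite K" "n < card K"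
  shows "ennreal \<epsilon> < minimal_error \<alpha> sq n d"
proof -
  have K: "K \<subseteq> frequencies d" "K \<noteq> {}"
    using assms(3,5) by (auto simp: low_frequencies_def)
  define W where "W = Max (sobolev_weight \<alpha> sq d ` K)"
  have W: "sobolev_weight \<alpha> sq d k \<le> W" if "k \<in> K" for k
    using that assms(4) by (simp add: W_def)
  have "W \<in> sobolev_weight \<alpha> sq d ` K"
    unfolding W_def using assms(4) K(2) by (intro Max_in) auto
  then obtain k0 where k0: "k0 \<in> K" "W = sobolev_weight \<alpha> sq d k0"
    by blast
  have W1: "1 \<le> W" "\<epsilon>\<^sup>2 * W < 1"
    using k0 assms(1,3) sobolev_weight_ge_1 by (auto simp: low_frequencies_def)
  have "ennreal (1 / sqrt W) \<le> minimal_error \<alpha> sq n d"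
    unfolding minimal_error_def
  proof (rule INF_greatest)
    fix A assume "A \<in> linear_algorithms \<alpha> sq n d"
    then obtain L g where A: "A = (\<lambda>f x. \<Sum>i<n. L i f * g i x)"
      and L: "\<forall>i<n. continuous_linear_functional \<alpha> sq d (L i)"
      unfolding linear_algorithms_def mem_Collect_eq by (elim exE conjE) (rule that)
    obtain c0 where c0: "\<exists>k\<in>K. c0 k \<noteq> 0" "\<forall>i<n. (\<Sum>k\<in>K. c0 k * L i (torus_exp d k)) = 0"
      using exists_annihilated_combination[OF assms(4,5), of "\<lambda>i k. L i (torus_exp d k)"] by blast
    define S where "S = (\<Sum>k\<in>K. (cmod (c0 k))\<^sup>2 * sobolev_weight \<alpha> sq d k)"
    have "S > 0"
    proof -
      obtain k where "k \<in> K" "c0 k \<noteq> 0" using c0 by blast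
      moreover have "0 < sobolev_weight \<alpha> sq d k" for k
        using sobolev_weight_ge_1[OF assms(1), of sq d k] by simp
      ultimately show ?thesis
        unfolding S_def using assms(4) by (intro sum_pos2[of K k]) (auto simp: less_imp_le)
    qed
    define c where "c k = c0 k / complex_of_real (sqrt S)" for k
    define f where "f = (\<lambda>x. \<Sum>m\<in>K. c m * torus_exp d m x)"
    note norms = trig_poly_norms[OF assms(1,4) K(1), where c = c, folded f_def]
    have c_sq: "(cmod (c k))\<^sup>2 = (cmod (c0 k))\<^sup>2 / S" for k
      using \<open>S > 0\<close> by (simp add: c_def norm_divide power_divide)
    have total: "(\<Sum>k\<in>K. (cmod (c k))\<^sup>2 * sobolev_weight \<alpha> sq d k) = 1"
      using \<open>S > 0\<close> by (simp add: c_sq sum_divide_distrib[symmetric] S_def[symmetric])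
    have "sobolev_norm \<alpha> sq d f \<le> 1"
      using norms(2)[of sq] total by (simp add: power2_le_imp_le[of "sobolev_norm \<alpha> sq d f" 1])
    have "L i f = 0" if "i < n" for i
    proof -
      have "L i f = (\<Sum>m\<in>K. c0 m * L i (torus_exp d m)) / complex_of_real (sqrt S)"
        unfolding f_def continuous_linear_functional_trig_poly[OF assms(1) L[rule_format, OF that] assms(4) K(1)]
        by (simp add: c_def sum_divide_distrib)
      then show ?thesis using c0(2) that by simp
    qed
    then have Af: "A f = (\<lambda>x. 0)" by (simp add: A)
    have "1 \<le> W * (\<Sum>k\<in>K. (cmod (c k))\<^sup>2)"
      unfolding total[symmetric] sum_distrib_left
      by (intro sum_mono) (simp add: W mult.commute[of W] mult_left_mono)
    then have "(1 / sqrt W)\<^sup>2 \<le> (L2_norm d f)\<^sup>2"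
      using W1 norms(3) by (simp add: power_divide field_simps)
    moreover have "0 \<le> L2_norm d f"
      by (simp add: L2_norm_def infsum_nonneg)
    ultimately have "1 / sqrt W \<le> L2_norm d f" by (rule power2_le_imp_le)
    then have "1 / sqrt W \<le> L2_norm d (\<lambda>x. f x - A f x)" by (simp add: Af)
    then show "ennreal (1 / sqrt W) \<le> (SUP f \<in> {f \<in> sobolev \<alpha> sq d. sobolev_norm \<alpha> sq d f \<le> 1}.
        ennreal (L2_norm d (\<lambda>x. f x - A f x)))"
      using norms(1) \<open>sobolev_norm \<alpha> sq d f \<le> 1\<close>
      by (intro SUP_upper2[of f]) (auto intro: ennreal_leI)
  qed
  moreover have "\<epsilon> < 1 / sqrt W"
  proof -
    have "\<epsilon> * sqrt W < 1"
      using W1 assms(2) by (intro power_less_imp_less_base[of "\<epsilon> * sqrt W" 2 1])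
        (simp_all add: power_mult_distrib)
    then show ?thesis using W1 by (simp add: field_simps)
  qed
  ultimately show ?thesis
    using assms(2) by (meson ennreal_lessI less_le_trans less_trans)
qed

lemma information_complexity_eq_card:
  assumes "\<alpha> > 0" "\<epsilon> > 0" "finite (low_frequencies \<alpha> sq \<epsilon> d)"
  shows "information_complexity \<alpha> sq \<epsilon> d = card (low_frequencies \<alpha> sq \<epsilon> d)"
  unfolding information_complexity_def
proof (rule Least_equality)
  show "minimal_error \<alpha> sq (card (low_frequencies \<alpha> sq \<epsilon> d)) d \<le> ennreal \<epsilon>"
    by (rule minimal_error_card_low_frequencies_le[OF assms])
  show "card (low_frequencies \<alpha> sq \<epsilon> d) \<le> n" if "minimal_error \<alpha> sq n d \<le> ennreal \<epsilon>" for n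
    using minimal_error_gt[OF assms(1,2) subset_refl assms(3), of n] that by (meson not_le)
qed

text \<open>
  Every bound on a low frequency comes from this inequality, with \<open>y powr c\<close> a lower bound of the
  weight.
\<close>

lemma less_powr_of_weighted_powr_less_1:
  fixes \<epsilon> c y :: real
  assumes "0 < \<epsilon>" "0 < c" "\<epsilon>\<^sup>2 * y powr c < 1"
  shows "y < \<epsilon> powr (- 2 / c)"
proof (rule ccontr)
  assume "\<not> y < \<epsilon> powr (- 2 / c)"
  then have "(\<epsilon> powr (- 2 / c)) powr c \<le> y powr c"
    using assms by (intro powr_mono2) auto
  then have "\<epsilon> powr (- 2) \<le> y powr c"
    using assms by (simp add: powr_powr)
  then have "\<epsilon>\<^sup>2 * \<epsilon> powr (- 2) \<le> \<epsilon>\<^sup>2 * y powr c"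
    by (intro mult_left_mono) auto
  moreover have "\<epsilon>\<^sup>2 * \<epsilon> powr (- 2) = 1"
    using assms by (simp add: powr_minus powr_numeral)
  ultimately show False using assms by simp
qed

text \<open>
  Bounding every component in terms of the weight confines the low frequencies to a box, which makes
  them finitely many for all three norms at once.
\<close>

lemma sobolev_weight_ge_component:
  assumes "\<alpha> > 0" "j < d"
  shows "\<bar>real_of_int (k j)\<bar> powr (2 * \<alpha>) \<le> sobolev_weight \<alpha> sq d k"
proof (cases sq)
  case Norm_plus
  have "\<bar>real_of_int (k j)\<bar>\<^sup>2 \<le> (\<Sum>j<d. \<bar>real_of_int (k j)\<bar>\<^sup>2)"
    using assms by (intro member_le_sum) auto
  then have "(\<bar>real_of_int (k j)\<bar>\<^sup>2) powr \<alpha> \<le> (1 + (\<Sum>j<d. \<bar>real_of_int (k j)\<bar>\<^sup>2)) powr \<alpha>"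
    using assms by (intro powr_mono2) auto
  moreover have "(\<bar>real_of_int (k j)\<bar>\<^sup>2) powr \<alpha> = \<bar>real_of_int (k j)\<bar> powr (2 * \<alpha>)"
    by (cases "k j = 0") (auto simp: powr_powr[symmetric] powr_numeral)
  ultimately show ?thesis using Norm_plus by simp
next
  case Norm_star
  have "\<bar>real_of_int (k j)\<bar> powr (2 * \<alpha>) \<le> (\<Sum>j<d. \<bar>real_of_int (k j)\<bar> powr (2 * \<alpha>))"
    using assms by (intro member_le_sum) auto
  then show ?thesis using Norm_star by simp
next
  case Norm_sharp
  have "\<bar>real_of_int (k j)\<bar> \<le> (\<Sum>j<d. \<bar>real_of_int (k j)\<bar>)"
    using assms by (intro member_le_sum) auto
  then show ?thesis using Norm_sharp assms by (auto intro!: powr_mono2)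
qed

lemma finite_low_frequencies:
  assumes "\<alpha> > 0" "\<epsilon> > 0"
  shows "finite (low_frequencies \<alpha> sq \<epsilon> d)"
proof (rule finite_subset)
  define M where "M = \<lceil>\<epsilon> powr (- 2 / (2 * \<alpha>))\<rceil>"
  show "low_frequencies \<alpha> sq \<epsilon> d \<subseteq> {..<d} \<rightarrow>\<^sub>E {- M..M}"
  proof
    fix k assume k: "k \<in> low_frequencies \<alpha> sq \<epsilon> d"
    have "k j \<in> {- M..M}" if "j < d" for j
    proof -
      have "\<epsilon>\<^sup>2 * \<bar>real_of_int (k j)\<bar> powr (2 * \<alpha>) \<le> \<epsilon>\<^sup>2 * sobolev_weight \<alpha> sq d k"
        by (intro mult_left_mono sobolev_weight_ge_component assms that) simp
      also have "\<dots> < 1" using k by (simp add: low_frequencies_def)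
      finally have "\<bar>real_of_int (k j)\<bar> < \<epsilon> powr (- 2 / (2 * \<alpha>))"
        by (rule less_powr_of_weighted_powr_less_1[rotated 2]) (use assms in simp_all)
      then have "\<bar>real_of_int (k j)\<bar> \<le> of_int M" unfolding M_def by linarith
      then show ?thesis by auto
    qed
    then show "k \<in> {..<d} \<rightarrow>\<^sub>E {- M..M}"
      using k by (auto simp: low_frequencies_def frequencies_def PiE_iff)
  qed
  show "finite ({..<d} \<rightarrow>\<^sub>E {- M..M})" by (intro finite_PiE) auto
qed

text \<open>
  The zero frequency has weight \<open>1\<close> and is therefore low for every \<open>\<epsilon> < 1\<close>.  So the cardinality
  is positive, and its logarithm is nonnegative and monotone as expected.
\<close>

lemma card_low_frequencies_pos:
  assumes "\<alpha> > 0" "0 < \<epsilon>" "\<epsilon> < 1"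
  shows "0 < card (low_frequencies \<alpha> sq \<epsilon> d)"
proof -
  have "sobolev_weight \<alpha> sq d (\<lambda>j\<in>{..<d}. 0) = 1"
    using assms by (cases sq) simp_all
  moreover have "\<epsilon>\<^sup>2 < 1"
    using assms by (simp add: power_less_one_iff)
  ultimately have "(\<lambda>j\<in>{..<d}. 0) \<in> low_frequencies \<alpha> sq \<epsilon> d"
    by (simp add: low_frequencies_def frequencies_def)
  then show ?thesis
    using finite_low_frequencies[OF assms(1,2)] by (auto simp: card_gt_0_iff)
qed

section \<open>Counting lattice points in simplices\<close>

lemma sum_geometric_symmetric:
  fixes q :: real
  assumes "q \<noteq> 1"
  shows "(\<Sum>i=-int n..int n. q ^ nat \<bar>i\<bar>) = (1 + q - 2 * q ^ Suc n) / (1 - q)"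
proof (induction n)
  case 0
  then show ?case using assms by (simp add: field_simps)
next
  case (Suc n)
  have "{- int (Suc n)..int (Suc n)} = insert (int (Suc n)) (insert (- int (Suc n)) {- int n..int n})"
    by auto
  then have "(\<Sum>i=-int (Suc n)..int (Suc n). q ^ nat \<bar>i\<bar>)
      = 2 * q ^ Suc n + (\<Sum>i=-int n..int n. q ^ nat \<bar>i\<bar>)"
    by (simp add: nat_add_distrib)
  then show ?case using Suc assms by (simp add: field_simps)
qed

text \<open>
  An exponential moment bound: every lattice point \<open>k\<close> of the simplex contributes at least \<open>1\<close> to
  the sum of \<open>q powr (\<bar>k 0\<bar> + \<dots> + \<bar>k (d - 1)\<bar> - r)\<close>, and over a box that sum factors into \<open>d\<close>
  truncated geometric series.  The free parameter \<open>q\<close> trades the dependence on \<open>r\<close> against the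
  dependence on \<open>d\<close>.
\<close>

lemma card_simplex_le:
  fixes q r :: real
  assumes "0 < q" "q < 1" "\<And>k. k \<in> K \<Longrightarrow> k \<in> frequencies d \<and> (\<Sum>j<d. \<bar>real_of_int (k j)\<bar>) \<le> r"
  shows "real (card K) \<le> q powr (- r) * ((1 + q) / (1 - q)) ^ d"
proof -
  define n where "n = nat \<lceil>r\<rceil>"
  define P where "P = {..<d} \<rightarrow>\<^sub>E {- int n..int n}"
  have "finite P" unfolding P_def by (intro finite_PiE) auto
  have "K \<subseteq> P"
  proof
    fix k assume k: "k \<in> K"
    have "k j \<in> {- int n..int n}" if "j < d" for j
    proof -
      have "\<bar>real_of_int (k j)\<bar> \<le> (\<Sum>j<d. \<bar>real_of_int (k j)\<bar>)"
        using that by (intro member_le_sum) auto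
      then have "\<bar>real_of_int (k j)\<bar> \<le> r" using assms(3)[OF k] by simp
      then have "\<bar>k j\<bar> \<le> int n" unfolding n_def by linarith
      then show ?thesis by auto
    qed
    then show "k \<in> P"
      using assms(3)[OF k] by (auto simp: P_def frequencies_def PiE_iff)
  qed
  have "real (card K) = (\<Sum>k\<in>K. 1)" by simp
  also have "\<dots> \<le> (\<Sum>k\<in>K. q powr (- r) * (\<Prod>j<d. q ^ nat \<bar>k j\<bar>))"
  proof (rule sum_mono)
    fix k assume "k \<in> K"
    have "(\<Prod>j<d. q ^ nat \<bar>k j\<bar>) = q powr (\<Sum>j<d. \<bar>real_of_int (k j)\<bar>)"
      using assms(1) by (simp add: powr_sum powr_realpow[symmetric])
    then have "q powr (- r) * (\<Prod>j<d. q ^ nat \<bar>k j\<bar>) = q powr ((\<Sum>j<d. \<bar>real_of_int (k j)\<bar>) - r)"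
      by (simp add: powr_add[symmetric])
    also have "\<dots> \<ge> 1"
      using assms(1,2) assms(3)[OF \<open>k \<in> K\<close>] powr_mono'[of "(\<Sum>j<d. \<bar>real_of_int (k j)\<bar>) - r" 0 q] by simp
    finally show "1 \<le> q powr (- r) * (\<Prod>j<d. q ^ nat \<bar>k j\<bar>)" .
  qed
  also have "\<dots> \<le> (\<Sum>k\<in>P. q powr (- r) * (\<Prod>j<d. q ^ nat \<bar>k j\<bar>))"
    using \<open>finite P\<close> \<open>K \<subseteq> P\<close> assms(1) by (intro sum_mono2) (auto intro!: prod_nonneg mult_nonneg_nonneg)
  also have "\<dots> = q powr (- r) * (\<Prod>j<d. \<Sum>i=-int n..int n. q ^ nat \<bar>i\<bar>)"
    unfolding P_def sum_distrib_left[symmetric] by (subst prod_sum_PiE) auto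
  also have "\<dots> \<le> q powr (- r) * ((1 + q) / (1 - q)) ^ d"
  proof (intro mult_left_mono)
    have "(\<Sum>i=-int n..int n. q ^ nat \<bar>i\<bar>) \<le> (1 + q) / (1 - q)"
      using assms(1,2) by (subst sum_geometric_symmetric) (auto intro!: divide_right_mono)
    then show "(\<Prod>j<d. \<Sum>i=-int n..int n. q ^ nat \<bar>i\<bar>) \<le> ((1 + q) / (1 - q)) ^ d"
      using assms(1) by (simp add: power_mono sum_nonneg)
  qed simp
  finally show ?thesis .
qed

section \<open>Sufficient conditions for weak tractability\<close>

lemma sublinear_powr_bound:
  fixes p C \<eta> :: real
  assumes "0 < p" "p < 1" "0 < C" "0 < \<eta>"
  shows "\<exists>B. \<forall>x>0. C * x powr p \<le> \<eta> * x + B"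
proof -
  \<comment> \<open>The point where \<open>C * x powr p\<close> and \<open>\<eta> * x\<close> cross.\<close>
  define X where "X = (C / \<eta>) powr (1 / (1 - p))"
  have X: "X powr (1 - p) = C / \<eta>" using assms by (simp add: X_def powr_powr)
  have "C * x powr p \<le> \<eta> * x + C * X powr p" if "x > 0" for x
  proof (cases "x \<le> X")
    case True
    then have "C * x powr p \<le> C * X powr p"
      using assms that by (intro mult_left_mono powr_mono2) auto
    then show ?thesis using assms that by (simp add: add_increasing)
  next
    case False
    then have "C / \<eta> \<le> x powr (1 - p)"
      unfolding X[symmetric] using assms by (intro powr_mono2) (auto simp: X_def)
    then have "C \<le> \<eta> * x powr (1 - p)" using assms by (simp add: field_simps)
    then have "C * x powr p \<le> \<eta> * x powr (1 - p) * x powr p"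
      by (intro mult_right_mono) auto
    also have "\<dots> = \<eta> * x" using that by (simp add: mult.assoc powr_add[symmetric])
    also have "\<dots> \<le> \<eta> * x + C * X powr p" using assms by simp
    finally show ?thesis .
  qed
  then show ?thesis by blast
qed

text \<open>
  Choosing \<open>q\<close> with \<open>(1 + q) / (1 - q) = exp \<eta>\<close> in the moment bound makes the dimension contribute
  \<open>\<eta> * d\<close> to the logarithm.  The radius contributes a fixed multiple of \<open>inverse \<epsilon> powr p\<close>, which is
  absorbed by \<open>\<eta> * inverse \<epsilon> + B\<close> because \<open>p < 1\<close>.
\<close>

lemma ln_card_low_frequencies_le:
  assumes "\<alpha> > 0" "0 < p" "p < 1" "0 < \<eta>"
    and simplex: "\<And>\<epsilon> d k. 0 < \<epsilon> \<Longrightarrow> k \<in> low_frequencies \<alpha> sq \<epsilon> d \<Longrightarrow>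
      (\<Sum>j<d. \<bar>real_of_int (k j)\<bar>) \<le> \<epsilon> powr (- p)"
  shows "\<exists>B. \<forall>\<epsilon> d. 0 < \<epsilon> \<and> \<epsilon> < 1 \<longrightarrow>
    ln (real (card (low_frequencies \<alpha> sq \<epsilon> d))) \<le> \<eta> * (inverse \<epsilon> + real d) + B"
proof -
  \<comment> \<open>The solution of \<open>(1 + q) / (1 - q) = exp \<eta>\<close>.\<close>
  define q where "q = (exp \<eta> - 1) / (exp \<eta> + 1)"
  have "0 < (E - 1) / (E + 1) \<and> (E - 1) / (E + 1) < 1 \<and>
      (1 + (E - 1) / (E + 1)) / (1 - (E - 1) / (E + 1)) = E" if "1 < E" for E :: real
    using that by (simp add: divide_simps)
  from this[of "exp \<eta>"] have q: "0 < q" "q < 1" "(1 + q) / (1 - q) = exp \<eta>"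
    using assms(4) by (simp_all add: q_def)
  obtain B where B: "\<And>x. x > 0 \<Longrightarrow> - ln q * x powr p \<le> \<eta> * x + B"
    using sublinear_powr_bound[OF assms(2,3) _ assms(4), of "- ln q"] q by auto
  have "ln (real (card (low_frequencies \<alpha> sq \<epsilon> d))) \<le> \<eta> * (inverse \<epsilon> + real d) + B"
    if \<epsilon>: "0 < \<epsilon>" "\<epsilon> < 1" for \<epsilon> d
  proof -
    have "real (card (low_frequencies \<alpha> sq \<epsilon> d)) \<le> q powr (- (\<epsilon> powr (- p))) * exp \<eta> ^ d"
      using card_simplex_le[OF q(1,2), of "low_frequencies \<alpha> sq \<epsilon> d" d "\<epsilon> powr (- p)"]
        simplex[OF \<epsilon>(1)] by (simp add: q(3)) (auto simp: low_frequencies_def)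
    also have "q powr (- (\<epsilon> powr (- p))) = exp (- ln q * inverse \<epsilon> powr p)"
      using q \<epsilon> by (simp add: powr_def ln_inverse)
    also have "exp (- ln q * inverse \<epsilon> powr p) * exp \<eta> ^ d =
        exp (- ln q * inverse \<epsilon> powr p + real d * \<eta>)"
      by (simp only: exp_add exp_of_nat_mult)
    finally have "ln (real (card (low_frequencies \<alpha> sq \<epsilon> d))) \<le> - ln q * inverse \<epsilon> powr p + real d * \<eta>"
      using card_low_frequencies_pos[OF assms(1) \<epsilon>, of sq d]
        ln_le_cancel_iff[of "real (card (low_frequencies \<alpha> sq \<epsilon> d))"]
      by (metis exp_gt_zero ln_exp of_nat_0_less_iff)
    also have "\<dots> \<le> \<eta> * (inverse \<epsilon> + real d) + B"
      using B[of "inverse \<epsilon>"] \<epsilon> by (simp add: algebra_simps)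
    finally show ?thesis .
  qed
  then show ?thesis by blast
qed

lemma weakly_tractable_if_simplex:
  assumes "\<alpha> > 0" "0 < p" "p < 1"
    and simplex: "\<And>\<epsilon> d k. 0 < \<epsilon> \<Longrightarrow> k \<in> low_frequencies \<alpha> sq \<epsilon> d \<Longrightarrow>
      (\<Sum>j<d. \<bar>real_of_int (k j)\<bar>) \<le> \<epsilon> powr (- p)"
  shows "weakly_tractable \<alpha> sq"
  unfolding weakly_tractable_def st_weakly_tractable_def
proof (intro allI impI)
  fix \<epsilon> :: "nat \<Rightarrow> real" and d :: "nat \<Rightarrow> nat"
  assume range: "\<forall>i. 0 < \<epsilon> i \<and> \<epsilon> i < 1 \<and> 1 \<le> d i"
    and lim: "filterlim (\<lambda>i. inverse (\<epsilon> i) + real (d i)) at_top sequentially"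
  let ?N = "\<lambda>i. information_complexity \<alpha> sq (\<epsilon> i) (d i)"
  let ?D = "\<lambda>i. inverse (\<epsilon> i) + real (d i)"
  have D: "\<epsilon> i powr (- 1) + real (d i) powr 1 = ?D i" for i
    using range[rule_format, of i] by (simp add: powr_minus)
  have N: "?N i = card (low_frequencies \<alpha> sq (\<epsilon> i) (d i))" for i
    using range assms(1) by (intro information_complexity_eq_card finite_low_frequencies) auto
  have "\<forall>\<^sub>F i in sequentially. \<bar>ln (real (?N i)) / ?D i\<bar> < \<delta>" if "\<delta> > 0" for \<delta> :: real
  proof -
    \<comment> \<open>Half of \<open>\<delta>\<close> goes to the slope; the other half absorbs \<open>B\<close> once the denominator is large.\<close>
    have "\<exists>B. \<forall>\<epsilon> d. 0 < \<epsilon> \<and> \<epsilon> < 1 \<longrightarrow>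
        ln (real (card (low_frequencies \<alpha> sq \<epsilon> d))) \<le> \<delta> / 2 * (inverse \<epsilon> + real d) + B"
      using that by (intro ln_card_low_frequencies_le[OF assms(1-3) _ simplex]) simp_all
    then obtain B where B: "\<And>i. ln (real (?N i)) \<le> \<delta> / 2 * ?D i + B"
      unfolding N using range by blast
    have "\<forall>\<^sub>F i in sequentially. ?D i > max 0 (2 * B / \<delta>)"
      using lim unfolding filterlim_at_top_dense by blast
    then show ?thesis
    proof eventually_elim
      case (elim i)
      have "0 \<le> ln (real (?N i))"
        using card_low_frequencies_pos[OF assms(1), of "\<epsilon> i" sq "d i"] range unfolding N
        by (simp add: Suc_le_eq)
      moreover have "ln (real (?N i)) < \<delta> * ?D i"
        using B[of i] elim that by (simp add: field_simps)
      ultimately show ?case using elim by (simp add: field_simps)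
    qed
  qed
  then show "(\<lambda>i. ln (real (?N i)) / (\<epsilon> i powr (- 1) + real (d i) powr 1)) \<longlonglongrightarrow> 0"
    unfolding D tendsto_iff dist_real_def by simp
qed

text \<open>
  For integers \<open>\<bar>z\<bar> \<le> z\<^sup>2\<close>, so lattice points of a ball of squared radius \<open>r\<close> lie in the simplex of
  size \<open>r\<close>.  Here \<open>r = \<epsilon> powr (- 2 / \<alpha>)\<close>, and \<open>2 / \<alpha> < 1\<close> exactly for \<open>\<alpha> > 2\<close>.
\<close>

lemma weakly_tractable_plus:
  assumes "\<alpha> > 2"
  shows "weakly_tractable \<alpha> Norm_plus"
proof (rule weakly_tractable_if_simplex[of _ "2 / \<alpha>"])
  fix \<epsilon> :: real and d k assume "0 < \<epsilon>" and k: "k \<in> low_frequencies \<alpha> Norm_plus \<epsilon> d"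
  have "\<bar>z\<bar> \<le> \<bar>z\<bar>\<^sup>2" for z :: int
    using self_le_power[of "\<bar>z\<bar>" 2] by (cases "z = 0") auto
  then have "\<bar>real_of_int z\<bar> \<le> \<bar>real_of_int z\<bar>\<^sup>2" for z
    by (metis of_int_abs of_int_le_iff of_int_power)
  then have "(\<Sum>j<d. \<bar>real_of_int (k j)\<bar>) \<le> (\<Sum>j<d. \<bar>real_of_int (k j)\<bar>\<^sup>2)"
    by (intro sum_mono)
  moreover have "1 + (\<Sum>j<d. \<bar>real_of_int (k j)\<bar>\<^sup>2) < \<epsilon> powr (- 2 / \<alpha>)"
    using k assms \<open>0 < \<epsilon>\<close> by (intro less_powr_of_weighted_powr_less_1) (auto simp: low_frequencies_def)
  ultimately show "(\<Sum>j<d. \<bar>real_of_int (k j)\<bar>) \<le> \<epsilon> powr - (2 / \<alpha>)"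
    by simp
qed (use assms in auto)

lemma weakly_tractable_sharp:
  assumes "\<alpha> > 1"
  shows "weakly_tractable \<alpha> Norm_sharp"
proof (rule weakly_tractable_if_simplex[of _ "1 / \<alpha>"])
  fix \<epsilon> :: real and d k assume "0 < \<epsilon>" and k: "k \<in> low_frequencies \<alpha> Norm_sharp \<epsilon> d"
  have "1 + (\<Sum>j<d. \<bar>real_of_int (k j)\<bar>) < \<epsilon> powr (- 2 / (2 * \<alpha>))"
    using k assms \<open>0 < \<epsilon>\<close> by (intro less_powr_of_weighted_powr_less_1) (auto simp: low_frequencies_def)
  then show "(\<Sum>j<d. \<bar>real_of_int (k j)\<bar>) \<le> \<epsilon> powr - (1 / \<alpha>)"
    by simp
qed (use assms in auto)

section \<open>Failure of tractability along a polynomial path\<close>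

text \<open>
  Half the exponent with which the largest weight on the cube \<open>{-1, 0, 1}\<close> to the power \<open>d\<close> grows
  in \<open>d\<close>.
\<close>

fun cube_exponent :: "real \<Rightarrow> norm_kind \<Rightarrow> real" where
  "cube_exponent \<alpha> Norm_plus = \<alpha> / 2"
| "cube_exponent \<alpha> Norm_star = 1 / 2"
| "cube_exponent \<alpha> Norm_sharp = \<alpha>"

lemma sobolev_weight_unit_cube_le:
  assumes "\<alpha> > 0" "\<And>j. j < d \<Longrightarrow> k j \<in> {-1, 0, 1}"
  shows "sobolev_weight \<alpha> sq d k \<le> (1 + real d) powr (2 * cube_exponent \<alpha> sq)"
proof -
  have le: "(\<Sum>j<d. g (k j)) \<le> real d" if "g (-1) \<le> 1" "g 0 \<le> 1" "g 1 \<le> 1" for g :: "int \<Rightarrow> real"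
    using sum_bounded_above[of "{..<d}" "\<lambda>j. g (k j)" 1] assms(2) that by fastforce
  show ?thesis
    using assms(1) le[of "\<lambda>z. \<bar>real_of_int z\<bar>\<^sup>2"] le[of "\<lambda>z. \<bar>real_of_int z\<bar> powr (2 * \<alpha>)"]
      le[of "\<lambda>z. \<bar>real_of_int z\<bar>"]
    by (cases sq) (auto intro!: powr_mono2 sum_nonneg add_nonneg_nonneg)
qed

text \<open>
  The base \<open>d + 2\<close> beats the bound \<open>1 + d\<close> on the weights in the cube strictly, so the whole cube is
  low.
\<close>

lemma card_low_frequencies_ge_unit_cube:
  assumes "\<alpha> > 0"
  shows "3 ^ d \<le> card (low_frequencies \<alpha> sq ((real d + 2) powr (- cube_exponent \<alpha> sq)) d)"
proof -
  define \<beta> where "\<beta> = cube_exponent \<alpha> sq"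
  define \<epsilon> where "\<epsilon> = (real d + 2) powr (- \<beta>)"
  have "\<beta> > 0" using assms by (cases sq) (auto simp: \<beta>_def)
  let ?Q = "{..<d} \<rightarrow>\<^sub>E {-1, 0, 1 :: int}"
  have "?Q \<subseteq> low_frequencies \<alpha> sq \<epsilon> d"
  proof
    fix k assume k: "k \<in> ?Q"
    have "\<epsilon>\<^sup>2 * sobolev_weight \<alpha> sq d k \<le> \<epsilon>\<^sup>2 * (1 + real d) powr (2 * \<beta>)"
      unfolding \<beta>_def using k by (intro mult_left_mono sobolev_weight_unit_cube_le assms) auto
    also have "\<dots> < \<epsilon>\<^sup>2 * (real d + 2) powr (2 * \<beta>)"
      using \<open>\<beta> > 0\<close> by (intro mult_strict_left_mono powr_less_mono2) (auto simp: \<epsilon>_def)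
    also have "\<dots> = 1"
      by (simp add: \<epsilon>_def power2_eq_square powr_add[symmetric])
    finally show "k \<in> low_frequencies \<alpha> sq \<epsilon> d"
      using k by (auto simp: low_frequencies_def frequencies_def)
  qed
  moreover have "finite (low_frequencies \<alpha> sq \<epsilon> d)"
    by (rule finite_low_frequencies) (simp_all add: assms \<epsilon>_def)
  ultimately have "card ?Q \<le> card (low_frequencies \<alpha> sq \<epsilon> d)"
    by (intro card_mono)
  moreover have "card ?Q = 3 ^ d" by (subst card_PiE) (simp_all add: numeral_3_eq_3)
  ultimately show ?thesis unfolding \<epsilon>_def \<beta>_def by simp
qed

text \<open>
  Along \<open>\<epsilon> = (d + 2) powr (- \<beta>)\<close> with \<open>\<beta> = cube_exponent \<alpha> sq\<close>, the logarithm of the complexity is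
  at least \<open>d * ln 3 \<ge> d\<close>, whereas \<open>\<epsilon> powr (- s) + d powr t\<close> is at most
  \<open>(d + 2) + d \<le> 4 * d\<close>.  Hence the quotient never drops below \<open>1 / 4\<close>.
\<close>

lemma not_st_weakly_tractable:
  assumes "\<alpha> > 0" "cube_exponent \<alpha> sq * s \<le> 1" "t \<le> 1"
  shows "\<not> st_weakly_tractable \<alpha> sq s t"
proof
  assume tractable: "st_weakly_tractable \<alpha> sq s t"
  define \<beta> where "\<beta> = cube_exponent \<alpha> sq"
  define d where "d i = Suc i" for i
  define \<epsilon> where "\<epsilon> i = (real (d i) + 2) powr (- \<beta>)" for i
  have "\<beta> > 0" using assms by (cases sq) (auto simp: \<beta>_def)
  have d: "1 \<le> d i" for i by (simp add: d_def)
  have \<epsilon>: "0 < \<epsilon> i" "\<epsilon> i < 1" for i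
    using \<open>\<beta> > 0\<close> powr_less_mono[of "- \<beta>" 0 "real (d i) + 2"] by (simp_all add: \<epsilon>_def)
  have "filterlim (\<lambda>i. real (d i)) at_top sequentially"
    unfolding d_def by (rule filterlim_compose[OF filterlim_real_sequentially filterlim_Suc])
  then have "filterlim (\<lambda>i. inverse (\<epsilon> i) + real (d i)) at_top sequentially"
    by (rule filterlim_at_top_mono) (use \<epsilon> in \<open>auto intro!: always_eventually less_imp_le\<close>)
  with tractable \<epsilon> d have "(\<lambda>i. ln (real (information_complexity \<alpha> sq (\<epsilon> i) (d i))) /
        (\<epsilon> i powr (- s) + real (d i) powr t)) \<longlonglongrightarrow> 0" (is "?ratio \<longlonglongrightarrow> 0")
    unfolding st_weakly_tractable_def by blast
  moreover have "1 / 4 \<le> ?ratio i" for i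
  proof -
    let ?N = "information_complexity \<alpha> sq (\<epsilon> i) (d i)"
    have "?N = card (low_frequencies \<alpha> sq (\<epsilon> i) (d i))"
      using \<epsilon> assms(1) by (intro information_complexity_eq_card finite_low_frequencies)
    then have "3 ^ d i \<le> ?N"
      using card_low_frequencies_ge_unit_cube[OF assms(1), where sq = sq and d = "d i"]
      by (simp add: \<epsilon>_def \<beta>_def)
    then have "3 ^ d i \<le> real ?N"
      by (metis of_nat_le_iff of_nat_numeral of_nat_power)
    then have "ln (3 ^ d i) \<le> ln (real ?N)"
      by (intro ln_mono) (simp_all add: less_le_trans[of 0 "3 ^ d i"])
    moreover have "1 \<le> ln (3 :: real)"
      using exp_le by (simp add: ln_ge_iff)
    then have "real (d i) \<le> real (d i) * ln 3"
      by (simp add: mult_le_cancel_left1)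
    ultimately have "real (d i) \<le> ln (real ?N)"
      by (simp add: ln_realpow)
    moreover have "\<epsilon> i powr (- s) + real (d i) powr t \<le> 4 * real (d i)"
    proof -
      have "\<epsilon> i powr (- s) \<le> (real (d i) + 2) powr 1"
        unfolding \<epsilon>_def powr_powr using assms(2) by (intro powr_mono) (auto simp: \<beta>_def)
      moreover have "real (d i) powr t \<le> real (d i) powr 1"
        using assms(3) d[of i] by (intro powr_mono) auto
      ultimately show ?thesis using d[of i] by simp
    qed
    moreover have "0 < \<epsilon> i powr (- s) + real (d i) powr t"
      using \<epsilon>(1)[of i] by (intro add_pos_nonneg) auto
    ultimately show ?thesis by (simp add: field_simps)
  qed
  ultimately have "1 / 4 \<le> (0 :: real)"
    by (intro LIMSEQ_le_const) auto
  then show False by simp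
qed

section \<open>The tractability dichotomy\<close>

theorem corollary4p3:
  fixes \<alpha> :: real
  assumes "\<alpha> > 0"
  shows "(weakly_tractable \<alpha> Norm_plus \<longleftrightarrow> \<alpha> > 2) \<and>
         (weakly_tractable \<alpha> Norm_sharp \<longleftrightarrow> \<alpha> > 1) \<and>
         \<not> weakly_tractable \<alpha> Norm_star \<and>
         (\<forall>sq. \<not> uniformly_weakly_tractable \<alpha> sq)"
proof (intro conjI allI iffI)
  have not_wt: "\<not> weakly_tractable \<alpha> sq" if "cube_exponent \<alpha> sq \<le> 1" for sq
    unfolding weakly_tractable_def using that assms by (intro not_st_weakly_tractable) auto
  show "weakly_tractable \<alpha> Norm_plus" if "\<alpha> > 2" using that by (rule weakly_tractable_plus)
  show "weakly_tractable \<alpha> Norm_sharp" if "\<alpha> > 1" using that by (rule weakly_tractable_sharp)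
  show "\<alpha> > 2" if "weakly_tractable \<alpha> Norm_plus" using that not_wt[of Norm_plus] by force
  show "\<alpha> > 1" if "weakly_tractable \<alpha> Norm_sharp" using that not_wt[of Norm_sharp] by force
  show "\<not> weakly_tractable \<alpha> Norm_star" by (rule not_wt) simp
  fix sq
  have "0 < cube_exponent \<alpha> sq" using assms by (cases sq) auto
  \<comment> \<open>This \<open>s\<close> makes \<open>\<epsilon> powr (- s)\<close> grow linearly in \<open>d\<close> along the path above.\<close>
  moreover from this have "\<not> st_weakly_tractable \<alpha> sq (1 / cube_exponent \<alpha> sq) 1"
    using assms by (intro not_st_weakly_tractable) auto
  ultimately show "\<not> uniformly_weakly_tractable \<alpha> sq"
    unfolding uniformly_weakly_tractable_def by (metis zero_less_divide_1_iff zero_less_one)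
qed

end
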